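(* If $f:X\to Y$ is a coarse map between coarsely proper metric spaces and if $\nu' f:\nu' X\to\nu' Y$ is surjective, then $f$ is coarsely surjective.
   Context: All metrics take finite values. For a metric space $X$, an entourage is a set $E\subseteq X^2$ with $\sup_{(x,y)\in E}d(x,y)<\infty$; a subset $B\subseteq X$ is bounded if $B^2$ is an entourage; $E[A]$ denotes the set of points of $X$ that are $E$-related to some point of $A$. A map $f:X\to Y$ is coarse if $(f\times f)(E)$ is an entourage for every entourage $E\subseteq X^2$ and $f^{-1}(B)$ is bounded for every bounded $B\subseteq Y$; it is coarsely surjective if there is an entourage $E\subseteq Y^2$ with $E[f(X)]=Y$. A metric space $X$ is coarsely proper if there is some $R_0>0$ such that for every bounded $B\subseteq X$ the cover of $B$ by the balls $B(x,R_0)=\{y\in X:d(x,y)\le R_0\}$, $x\in B$, has a finite subcover. Subsets $A,B\subseteq X$ are coarsely disjoint if $E[A]\cap E[B]$ is bounded for every entourage $E$; otherwise they are close, $A\curlywedge B$. A coarse ultrafilter on $X$ is a system $\mathcal F$ of subsets of $X$ such that (1) $A,B\in\mathcal F$ implies $A\curlywedge B$; (2) if $A,B\subseteq X$ and $A\cup B\in\mathcal F$ then $A\in\mathcal F$ or $B\in\mathcal F$; (3) $X\in\mathcal F$. Two coarse ultrafilters $\mathcal F,\mathcal G$ are asymptotically alike, $\mathcal F\lambda\mathcal G$, if $A\curlywedge B$ for all $A\in\mathcal F$, $B\in\mathcal G$; this is an equivalence relation. The corona $\nu' X$ is, as a set, the set of coarse ultrafilters on $X$ modulo $\lambda$. A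 coarse map $f:X\to Y$ induces the map $\nu' f:\nu' X\to\nu' Y$, $[\mathcal F]\mapsto[f_*\mathcal F]$, where $f_*\mathcal F=\{A\subseteq Y:f^{-1}(A)\in\mathcal F\}$. *)

theory Defs
  imports "HOL-Analysis.Analysis"
begin

text \<open>Metric spaces are types of class \<open>metric_space\<close>; in particular they are nonempty. This
  convention matters: the empty map into a nonempty bounded space is coarse and both coronas are
  empty, but the map is not coarsely surjective.\<close>

definition entourage :: "('a::metric_space \<times> 'a) set \<Rightarrow> bool" where
  "entourage E \<longleftrightarrow> bdd_above ((\<lambda>(x, y). dist x y) ` E)"

lemma entourage_iff: "entourage E \<longleftrightarrow> (\<exists>R. \<forall>(x, y)\<in>E. dist x y \<le> R)"
  by (fastforce simp: entourage_def bdd_above_def)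

text \<open>Boundedness in the coarse sense is the library's \<^const>\<open>bounded\<close>.\<close>

lemma bounded_iff_entourage: "bounded B \<longleftrightarrow> entourage (B \<times> B)"
  unfolding entourage_iff bounded_two_points by fastforce

definition coarse_map :: "('a::metric_space \<Rightarrow> 'b::metric_space) \<Rightarrow> bool" where
  "coarse_map f \<longleftrightarrow>
     (\<forall>E. entourage E \<longrightarrow> entourage (map_prod f f ` E)) \<and>
     (\<forall>B. bounded B \<longrightarrow> bounded (f -` B))"

text \<open>\<open>E[A]\<close> is rendered as the relational image \<open>E `` A\<close>. The orientation of the pairs is
  immaterial below, since entourages are closed under converse.\<close>

definition coarsely_surjective :: "('a::metric_space \<Rightarrow> 'b::metric_space) \<Rightarrow> bool" where
  "coarsely_surjective f \<longleftrightarrow> (\<exists>E. entourage E \<and> E `` range f = UNIV)"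

definition coarsely_proper :: "'a::metric_space itself \<Rightarrow> bool" where
  "coarsely_proper TYPE('a) \<longleftrightarrow>
     (\<exists>R\<^sub>0>0. \<forall>B :: 'a set. bounded B \<longrightarrow>
        (\<exists>S. finite S \<and> S \<subseteq> B \<and> B \<subseteq> (\<Union>x\<in>S. cball x R\<^sub>0)))"

definition coarsely_disjoint :: "'a::metric_space set \<Rightarrow> 'a set \<Rightarrow> bool" where
  "coarsely_disjoint A B \<longleftrightarrow> (\<forall>E. entourage E \<longrightarrow> bounded (E `` A \<inter> E `` B))"

definition close :: "'a::metric_space set \<Rightarrow> 'a set \<Rightarrow> bool" where
  "close A B \<longleftrightarrow> \<not> coarsely_disjoint A B"

definition coarse_ultrafilter :: "'a::metric_space set set \<Rightarrow> bool" where
  "coarse_ultrafilter F \<longleftrightarrow>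
     (\<forall>A\<in>F. \<forall>B\<in>F. close A B) \<and>
     (\<forall>A B. A \<union> B \<in> F \<longrightarrow> A \<in> F \<or> B \<in> F) \<and>
     UNIV \<in> F"

definition asymptotically_alike :: "('a::metric_space set set \<times> 'a set set) set" where
  "asymptotically_alike =
     {(F, G). coarse_ultrafilter F \<and> coarse_ultrafilter G \<and> (\<forall>A\<in>F. \<forall>B\<in>G. close A B)}"

definition corona :: "'a::metric_space set set set set" where
  "corona = Collect coarse_ultrafilter // asymptotically_alike"

definition pushforward :: "('a \<Rightarrow> 'b) \<Rightarrow> 'a set set \<Rightarrow> 'b set set" where
  "pushforward f F = {A. f -` A \<in> F}"

text \<open>The induced map on classes; by \<open>corona_map_class\<close> below, it sends the class of \<open>F\<close> to the
  class of \<open>pushforward f F\<close> whenever \<open>f\<close> is coarse.\<close>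

definition corona_map ::
    "('a::metric_space \<Rightarrow> 'b::metric_space) \<Rightarrow> 'a set set set \<Rightarrow> 'b set set set" where
  "corona_map f C = (\<Union>F\<in>C. asymptotically_alike `` {pushforward f F})"

lemma coarsely_disjoint_iff:
  "coarsely_disjoint A B \<longleftrightarrow>
     (\<forall>R. bounded {x. (\<exists>a\<in>A. dist a x \<le> R) \<and> (\<exists>b\<in>B. dist b x \<le> R)})"
proof
  assume d: "coarsely_disjoint A B"
  show "\<forall>R. bounded {x. (\<exists>a\<in>A. dist a x \<le> R) \<and> (\<exists>b\<in>B. dist b x \<le> R)}"
  proof
    fix R
    have "entourage {(x::'a, y). dist x y \<le> R}"
      unfolding entourage_iff by auto
    with d have "bounded ({(x, y). dist x y \<le> R} `` A \<inter> {(x, y). dist x y \<le> R} `` B)"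
      unfolding coarsely_disjoint_def by blast
    then show "bounded {x. (\<exists>a\<in>A. dist a x \<le> R) \<and> (\<exists>b\<in>B. dist b x \<le> R)}"
      by (rule bounded_subset) auto
  qed
next
  assume b: "\<forall>R. bounded {x. (\<exists>a\<in>A. dist a x \<le> R) \<and> (\<exists>b\<in>B. dist b x \<le> R)}"
  show "coarsely_disjoint A B"
    unfolding coarsely_disjoint_def
  proof (intro allI impI)
    fix E :: "('a \<times> 'a) set"
    assume "entourage E"
    then obtain R where "\<forall>(x, y)\<in>E. dist x y \<le> R"
      unfolding entourage_iff by blast
    then have "E `` A \<inter> E `` B \<subseteq> {x. (\<exists>a\<in>A. dist a x \<le> R) \<and> (\<exists>b\<in>B. dist b x \<le> R)}"
      by blast
    with b show "bounded (E `` A \<inter> E `` B)"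
      using bounded_subset by blast
  qed
qed

lemma close_sym: "close A B \<Longrightarrow> close B A"
  unfolding close_def coarsely_disjoint_def by (simp add: Int_commute)

lemma coarsely_disjoint_separation:
  assumes "coarsely_disjoint A C"
  obtains D where "coarsely_disjoint A D" "coarsely_disjoint (- D) C"
proof
  define D where "D = {y. \<exists>c\<in>C. \<forall>a\<in>A. dist c y \<le> dist a y}"
  have b: "bounded {x. (\<exists>a\<in>A. dist a x \<le> R) \<and> (\<exists>c\<in>C. dist c x \<le> R)}" for R
    using assms unfolding coarsely_disjoint_iff by blast
  have tri: "dist u x \<le> 3 * R"
    if "dist u y \<le> dist v y" "dist v x \<le> R" "dist y x \<le> R" for u v x y :: 'a and R
    using that dist_triangle[of u x y] dist_triangle2[of v y x] by linarith
  have pos: "dist v x \<le> 3 * R" if "dist v x \<le> R" for v x :: 'a and R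
    using that zero_le_dist[of v x] by linarith
  show "coarsely_disjoint A D"
    unfolding coarsely_disjoint_iff
  proof
    fix R
    show "bounded {x. (\<exists>a\<in>A. dist a x \<le> R) \<and> (\<exists>d\<in>D. dist d x \<le> R)}"
      by (rule bounded_subset[OF b[of "3 * R"]]) (use tri pos in \<open>auto simp: D_def; meson\<close>)
  qed
  show "coarsely_disjoint (- D) C"
    unfolding coarsely_disjoint_iff
  proof
    fix R
    have "\<exists>a\<in>A. dist a y \<le> dist c y" if "y \<in> - D" "c \<in> C" for c y
      using that unfolding D_def by (auto simp: not_le intro: less_imp_le)
    then show "bounded {x. (\<exists>d\<in>-D. dist d x \<le> R) \<and> (\<exists>c\<in>C. dist c x \<le> R)}"
      by (intro bounded_subset[OF b[of "3 * R"]]) (use tri pos in \<open>blast\<close>)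
  qed
qed

lemma equiv_asymptotically_alike:
  "equiv (Collect coarse_ultrafilter) (asymptotically_alike :: ('a::metric_space set set \<times> _) set)"
  (is "equiv ?U ?R")
proof (rule equivI)
  show "?R \<subseteq> ?U \<times> ?U"
    by (auto simp: asymptotically_alike_def)
  show "refl_on ?U ?R"
    by (auto simp: refl_on_def asymptotically_alike_def coarse_ultrafilter_def)
  show "sym ?R"
    by (auto simp: sym_def asymptotically_alike_def intro: close_sym)
  show "trans ?R"
  proof (rule transI)
    fix F G H :: "'a set set"
    assume FG: "(F, G) \<in> asymptotically_alike" and GH: "(G, H) \<in> asymptotically_alike"
    have "close A C" if "A \<in> F" "C \<in> H" for A C
    proof (rule ccontr)
      assume "\<not> close A C"
      then obtain D where D: "coarsely_disjoint A D" "coarsely_disjoint (- D) C"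
        using coarsely_disjoint_separation unfolding close_def by blast
      have "D \<union> - D \<in> G"
        using FG by (auto simp: asymptotically_alike_def coarse_ultrafilter_def)
      then have "D \<in> G \<or> - D \<in> G"
        using FG unfolding asymptotically_alike_def coarse_ultrafilter_def by blast
      with D FG GH that show False
        by (auto simp: asymptotically_alike_def close_def)
    qed
    with FG GH show "(F, H) \<in> asymptotically_alike"
      by (auto simp: asymptotically_alike_def)
  qed
qed

lemma close_vimage:
  assumes "coarse_map f" "close (f -` A) (f -` B)"
  shows "close A B"
  unfolding close_def
proof
  assume d: "coarsely_disjoint A B"
  have "bounded (E `` (f -` A) \<inter> E `` (f -` B))" if "entourage E" for E
  proof -
    let ?E = "map_prod f f ` E"
    have "bounded (?E `` A \<inter> ?E `` B)"
      using d assms(1) that unfolding coarsely_disjoint_def coarse_map_def by blast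
    then have "bounded (f -` (?E `` A \<inter> ?E `` B))"
      using assms(1) unfolding coarse_map_def by blast
    then show ?thesis
      by (rule bounded_subset) force
  qed
  with assms(2) show False
    unfolding close_def coarsely_disjoint_def by blast
qed

lemma coarse_ultrafilter_pushforward:
  "coarse_map f \<Longrightarrow> coarse_ultrafilter F \<Longrightarrow> coarse_ultrafilter (pushforward f F)"
  unfolding coarse_ultrafilter_def pushforward_def by (auto simp: close_vimage)

lemma corona_map_class:
  assumes "coarse_map f" "coarse_ultrafilter F"
  shows "corona_map f (asymptotically_alike `` {F}) = asymptotically_alike `` {pushforward f F}"
  unfolding corona_map_def
proof (rule UN_equiv_class[OF equiv_asymptotically_alike])
  show "(\<lambda>F. asymptotically_alike `` {pushforward f F}) respects asymptotically_alike"
  proof (rule congruentI)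
    fix F G :: "'a set set"
    assume "(F, G) \<in> asymptotically_alike"
    then have "(pushforward f F, pushforward f G) \<in> asymptotically_alike"
      using assms(1) coarse_ultrafilter_pushforward[OF assms(1)] close_vimage[OF assms(1)]
      by (auto simp: asymptotically_alike_def pushforward_def)
    then show "asymptotically_alike `` {pushforward f F} = asymptotically_alike `` {pushforward f G}"
      by (rule equiv_class_eq[OF equiv_asymptotically_alike])
  qed
qed (use assms in simp)

end

theory Submission
  imports Defs
begin

text \<open>If \<open>f\<close> is not coarsely surjective, there are points \<open>y n\<close> at distance more than \<open>n\<close>
  from the image of \<open>f\<close>. The image of a free ultrafilter on the naturals under \<open>y\<close> is a coarse
  ultrafilter containing \<open>range y\<close>. It cannot be asymptotically alike to any pushforward under
  \<open>f\<close>, since every pushforward contains \<open>range f\<close>, which is coarsely disjoint from \<open>range y\<close>.\<close>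

text \<open>Zorn's lemma for the proper filters below \<open>F\<close>, ordered by
  \<open>\<ge>\<close> so that a maximal element is a minimal proper filter. Minimality is what
  makes \<open>U\<close> decide every predicate.\<close>

lemma ultrafilter_below:
  fixes F :: "'a filter"
  assumes "F \<noteq> bot"
  obtains U where "U \<le> F" "U \<noteq> bot" "\<And>P. eventually P U \<or> eventually (\<lambda>x. \<not> P x) U"
proof -
  define A where "A = {G. G \<le> F \<and> G \<noteq> bot}"
  have "\<exists>U\<in>A. \<forall>G\<in>A. U \<ge> G \<longrightarrow> G = U"
  proof (rule predicate_Zorn)
    show "partial_order_on A (relation_of (\<ge>) A)"
      by (rule partial_order_on_relation_ofI) auto
  next
    fix C assume "C \<in> Chains (relation_of (\<ge>) A)"
    then have C: "C \<subseteq> A" "\<And>G H. G \<in> C \<Longrightarrow> H \<in> C \<Longrightarrow> G \<le> H \<or> H \<le> G"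
      by (auto simp: Chains_def relation_of_def)
    show "\<exists>u\<in>A. \<forall>G\<in>C. u \<le> G"
    proof (cases "C = {}")
      case True
      then show ?thesis using assms by (auto simp: A_def)
    next
      case False
      \<comment> \<open>A nonempty chain is directed, hence a base of its infimum: were
        \<open>Inf C\<close> improper, some member of \<open>C\<close> would already be.\<close>
      have "eventually (\<lambda>_. False) (Inf C) \<longleftrightarrow> (\<exists>G\<in>C. eventually (\<lambda>_. False) G)"
        using False by (rule eventually_Inf_base) (metis C(2) inf.absorb1 inf.absorb2 order_refl)
      then have "Inf C \<noteq> bot"
        using C(1) by (auto simp: A_def trivial_limit_def)
      moreover from False C(1) have "Inf C \<le> F"
        unfolding A_def by (blast intro: Inf_lower2)
      ultimately show ?thesis
        by (auto simp: A_def intro!: bexI[of _ "Inf C"] Inf_lower)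
    qed
  qed
  then obtain U where U: "U \<in> A" and min: "\<And>G. G \<in> A \<Longrightarrow> G \<le> U \<Longrightarrow> G = U"
    by blast
  have "eventually P U" if "\<not> eventually (\<lambda>x. \<not> P x) U" for P
  proof -
    \<comment> \<open>Restricting \<open>U\<close> to \<open>P\<close> keeps it proper, because the
      negation of \<open>P\<close> is not eventually true; by minimality the restriction changes
      nothing.\<close>
    let ?G = "inf U (principal {x. P x})"
    have "?G \<noteq> bot"
      using that by (simp add: trivial_limit_def eventually_inf_principal)
    then have "?G = U"
      using U by (intro min) (auto simp: A_def intro: le_infI1)
    moreover have "eventually P ?G"
      by (simp add: eventually_inf_principal)
    ultimately show ?thesis by simp
  qed
  with U show thesis
    by (intro that[of U]) (auto simp: A_def)
qed

text \<open>The diagonal is an entourage and leaves both sets as they are, so it alone refutes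
  coarse disjointness.\<close>

lemma close_if_unbounded_Int:
  assumes "\<not> bounded (A \<inter> B)"
  shows "close A B"
proof -
  have "entourage Id"
    by (auto simp: entourage_iff)
  with assms show ?thesis
    unfolding close_def coarsely_disjoint_def by (metis Image_Id)
qed

text \<open>The hypothesis says that \<open>y\<close> tends to infinity. With \<open>U\<close> below
  \<open>cofinite\<close>, this keeps bounded sets out of \<open>F\<close>; as \<open>F\<close> is
  closed under intersections, any two members meet in an unbounded set.\<close>

lemma coarse_ultrafilter_of_sequence:
  fixes y :: "nat \<Rightarrow> 'a::metric_space"
  assumes "\<And>B. bounded B \<Longrightarrow> finite (y -` B)"
  obtains F where "coarse_ultrafilter F" "range y \<in> F"
proof -
  obtain U :: "nat filter" where U: "U \<le> cofinite" "U \<noteq> bot"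
    and ultra: "\<And>P. eventually P U \<or> eventually (\<lambda>n. \<not> P n) U"
    using ultrafilter_below[of "cofinite :: nat filter"] by auto
  define F where "F = {A. \<forall>\<^sub>F n in U. y n \<in> A}"
  have "close A B" if AB: "A \<in> F" "B \<in> F" for A B
  proof (rule close_if_unbounded_Int)
    have *: "\<forall>\<^sub>F n in U. y n \<in> A \<inter> B"
      using AB by (simp add: F_def eventually_conj)
    show "\<not> bounded (A \<inter> B)"
    proof
      assume "bounded (A \<inter> B)"
      then have "\<forall>\<^sub>F n in cofinite. y n \<notin> A \<inter> B"
        using assms[of "A \<inter> B"] by (simp add: eventually_cofinite vimage_def)
      then have "\<forall>\<^sub>F n in U. y n \<notin> A \<inter> B"
        by (rule filter_leD[OF U(1)])
      with * have "\<forall>\<^sub>F n in U. False"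
        by eventually_elim blast
      with U(2) show False
        by (simp add: trivial_limit_def)
    qed
  qed
  moreover have "A \<in> F \<or> B \<in> F" if "A \<union> B \<in> F" for A B
    using ultra[of "\<lambda>n. y n \<in> A"]
  proof
    assume "\<forall>\<^sub>F n in U. y n \<notin> A"
    moreover have "\<forall>\<^sub>F n in U. y n \<in> A \<union> B"
      using that by (simp add: F_def)
    ultimately have "\<forall>\<^sub>F n in U. y n \<in> B"
      by eventually_elim blast
    then show ?thesis by (simp add: F_def)
  qed (simp add: F_def)
  ultimately have "coarse_ultrafilter F"
    by (simp add: coarse_ultrafilter_def F_def)
  moreover have "range y \<in> F"
    by (simp add: F_def)
  ultimately show thesis by (rule that)
qed

lemma close_range_if_corona_map_surj:
  fixes f :: "'a::metric_space \<Rightarrow> 'b::metric_space"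
  assumes f: "coarse_map f" and surj: "corona \<subseteq> corona_map f ` corona"
    and F: "coarse_ultrafilter F" "A \<in> F"
  shows "close A (range f)"
proof -
  have "asymptotically_alike `` {F} \<in> corona"
    unfolding corona_def using F(1) by (simp add: quotientI)
  with surj obtain C where C: "C \<in> corona" "asymptotically_alike `` {F} = corona_map f C"
    by blast
  then obtain G where G: "coarse_ultrafilter G" "C = asymptotically_alike `` {G}"
    unfolding corona_def by (auto elim: quotientE)
  then have "asymptotically_alike `` {F} = asymptotically_alike `` {pushforward f G}"
    using C(2) corona_map_class[OF f G(1)] by simp
  then have "(F, pushforward f G) \<in> asymptotically_alike"
    using eq_equiv_class[OF _ equiv_asymptotically_alike] coarse_ultrafilter_pushforward[OF f G(1)]
    by blast
  moreover have "f -` range f = UNIV"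
    by blast
  then have "range f \<in> pushforward f G"
    using G(1) by (simp add: pushforward_def coarse_ultrafilter_def)
  ultimately show ?thesis
    using F(2) by (auto simp: asymptotically_alike_def)
qed

lemma not_coarsely_surjective_far_sequence:
  assumes "\<not> coarsely_surjective f"
  obtains y :: "nat \<Rightarrow> 'b::metric_space" where "\<And>n x. dist (f x) (y n) > real n"
proof -
  have "\<exists>y. \<forall>x. dist (f x) y > real n" for n
  proof -
    \<comment> \<open>A point missed by the closed \<open>n\<close>-neighbourhood of the image
      serves as \<open>y n\<close>.\<close>
    let ?E = "{(u, v). dist u v \<le> real n}"
    have "entourage ?E"
      by (auto simp: entourage_iff)
    then have "?E `` range f \<noteq> UNIV"
      using assms by (auto simp: coarsely_surjective_def)
    then obtain y where "y \<notin> ?E `` range f"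
      by blast
    then have "\<forall>x. dist (f x) y > real n"
      by (force simp: not_le)
    then show ?thesis by blast
  qed
  then show thesis
    using that by metis
qed

theorem theorem40:
  fixes f :: "'a::metric_space \<Rightarrow> 'b::metric_space"
  assumes "coarsely_proper TYPE('a)"
    and "coarsely_proper TYPE('b)"
    and "coarse_map f"
    and "corona_map f ` corona = corona"
  shows "coarsely_surjective f"
proof (rule ccontr)
  assume "\<not> coarsely_surjective f"
  then obtain y where far: "\<And>n x. dist (f x) (y n) > real n"
    using not_coarsely_surjective_far_sequence by blast
  have "finite (y -` B)" if "bounded B" for B
  proof -
    \<comment> \<open>The centre \<open>f undefined\<close> is an arbitrary point of the image.
      Since \<open>y n\<close> is farther than \<open>n\<close> from it, only indices below
      \<open>R\<close> can land in \<open>B\<close>.\<close>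
    obtain R where R: "\<And>z. z \<in> B \<Longrightarrow> dist (f undefined) z \<le> R"
      using \<open>bounded B\<close> by (metis bounded_any_center)
    have "y -` B \<subseteq> {..nat \<lceil>R\<rceil>}"
    proof
      fix n assume "n \<in> y -` B"
      then have "real n < R"
        using far[of n undefined] R[of "y n"] by simp
      then show "n \<in> {..nat \<lceil>R\<rceil>}"
        by simp linarith
    qed
    then show ?thesis
      using finite_subset by blast
  qed
  then obtain F where "coarse_ultrafilter F" "range y \<in> F"
    using coarse_ultrafilter_of_sequence by blast
  then have "close (range y) (range f)"
    using close_range_if_corona_map_surj assms(3,4) by blast
  moreover have "coarsely_disjoint (range y) (range f)"
    unfolding coarsely_disjoint_iff
  proof
    fix R :: real
    \<comment> \<open>A point within \<open>R\<close> of both \<open>y n\<close> and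
      \<open>f x\<close> forces their distance, which exceeds \<open>n\<close>, to be at most
      \<open>2 * R\<close>. So only finitely many \<open>y n\<close> matter, and finitely many balls
      cover the intersection of the neighbourhoods.\<close>
    let ?N = "nat \<lceil>2 * R\<rceil>"
    have "\<exists>n\<le>?N. dist (y n) z \<le> R" if "dist (y n) z \<le> R" "dist (f x) z \<le> R" for n x z
    proof -
      have "real n < 2 * R"
        using far[of n x] that dist_triangle2[of "f x" "y n" z] by linarith
      then have "n \<le> ?N"
        by linarith
      with that show ?thesis by blast
    qed
    then have "{z. (\<exists>a\<in>range y. dist a z \<le> R) \<and> (\<exists>b\<in>range f. dist b z \<le> R)}
        \<subseteq> (\<Union>n\<le>?N. {z. dist (y n) z \<le> R})"
      by blast
    then show "bounded {z. (\<exists>a\<in>range y. dist a z \<le> R) \<and> (\<exists>b\<in>range f. dist b z \<le> R)}"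
      by (rule bounded_subset[rotated]) (auto simp flip: cball_def)
  qed
  ultimately show False
    by (simp add: close_def)
qed

end
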